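(* The functor $(\ )^{\mathsf{Hey}}:\mathsf{Hil}_0^{\vee}\to\mathsf{Hey}$, given by $H\mapsto H^{\mathsf{Hey}}$ and $f\mapsto f^{\mathsf{Hey}}$, is left adjoint to the forgetful functor $\mathrm{U}:\mathsf{Hey}\to\mathsf{Hil}_0^{\vee}$.
   Context: A Hilbert algebra is an algebra $(H,\to,1)$ of type $(2,0)$ such that for all $a,b,c\in H$: $a\to(b\to a)=1$; $(a\to(b\to c))\to((a\to b)\to(a\to c))=1$; and $a\to b=b\to a=1$ implies $a=b$. It is ordered by $a\le b$ iff $a\to b=1$. A Hilbert algebra with supremum is an algebra $(H,\vee,\to,1)$ of type $(2,2,0)$ such that $(H,\to,1)$ is a Hilbert algebra, $(H,\vee,1)$ is a join semilattice with greatest element $1$, and for all $a,b$: $a\to b=1$ iff $a\vee b=b$. $\mathsf{Hil}_0^{\vee}$ is the category whose objects are algebras $(H,\vee,\to,0,1)$ of type $(2,2,0,0)$ such that $(H,\vee,\to,1)$ is a Hilbert algebra with supremum and $0\le x$ for all $x\in H$, and whose morphisms are the maps preserving $\vee,\to,0,1$. $\mathsf{Hey}$ is the category of Heyting algebras $(H,\wedge,\vee,\to,0,1)$ and homomorphisms; the forgetful functor $\mathrm{U}:\mathsf{Hey}\to\mathsf{Hil}_0^{\vee}$ forgets $\wedge$. An implicative filter of a Hilbert algebra $H$ is a subset $F\subseteq H$ with $1\in F$ and such that $a\in F$, $a\to b\in F$ imply $b\in F$. It is irreducible if it is proper and, for all implicative filters $F_1,F_2$, $F=F_1\cap F_2$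 implies $F=F_1$ or $F=F_2$. $X(H)$ is the set of irreducible implicative filters of $H$, ordered by inclusion. For $a\in H$, $\varphi(a)=\{P\in X(H):a\in P\}$. $X(H)^+$ is the set of upsets of $(X(H),\subseteq)$, a complete Heyting algebra under $\cap,\cup$ and $U\Rightarrow V=(U\cap V^c]^c$, where $(Y]$ is the downset generated by $Y$ and $Y^c$ the complement in $X(H)$. For $H\in\mathsf{Hil}_0^{\vee}$, $H^{\mathsf{Hey}}$ is the Heyting subalgebra of $X(H)^+$ generated by $\varphi[H]$. For a morphism $f:H\to G$ in $\mathsf{Hil}_0^{\vee}$, $R_f\subseteq X(G)\times X(H)$ is defined by $(P,Q)\in R_f$ iff $f^{-1}(P)\subseteq Q$, and $R_f(P)=\{Q\in X(H):(P,Q)\in R_f\}$. The map $f^{\mathsf{Hey}}:H^{\mathsf{Hey}}\to G^{\mathsf{Hey}}$ is $f^{\mathsf{Hey}}(U)=\{P\in X(G):R_f(P)\subseteq U\}$. These assignments define a functor $(\ )^{\mathsf{Hey}}:\mathsf{Hil}_0^{\vee}\to\mathsf{Hey}$. *)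

theory Defs
  imports Main "HOL-Library.FuncSet"
begin

record 'a hilbert =
  carrier :: "'a set"
  imp :: "'a \<Rightarrow> 'a \<Rightarrow> 'a"
  one :: 'a

record 'a hil0 = "'a hilbert" +
  join :: "'a \<Rightarrow> 'a \<Rightarrow> 'a"
  zero :: 'a

record 'a hey = "'a hil0" +
  meet :: "'a \<Rightarrow> 'a \<Rightarrow> 'a"

definition closed_op :: "'a set \<Rightarrow> ('a \<Rightarrow> 'a \<Rightarrow> 'a) \<Rightarrow> bool" where
  "closed_op S m \<longleftrightarrow> (\<forall>a\<in>S. \<forall>b\<in>S. m a b \<in> S)"

definition hilbert_algebra :: "('a, 'z) hilbert_scheme \<Rightarrow> bool" where
  "hilbert_algebra H \<longleftrightarrow>
     closed_op (carrier H) (imp H) \<and> one H \<in> carrier H \<and>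
     (\<forall>a\<in>carrier H. \<forall>b\<in>carrier H. imp H a (imp H b a) = one H) \<and>
     (\<forall>a\<in>carrier H. \<forall>b\<in>carrier H. \<forall>c\<in>carrier H.
        imp H (imp H a (imp H b c)) (imp H (imp H a b) (imp H a c)) = one H) \<and>
     (\<forall>a\<in>carrier H. \<forall>b\<in>carrier H. imp H a b = one H \<and> imp H b a = one H \<longrightarrow> a = b)"

definition hilbert_le :: "('a, 'z) hilbert_scheme \<Rightarrow> 'a \<Rightarrow> 'a \<Rightarrow> bool" where
  "hilbert_le H a b \<longleftrightarrow> imp H a b = one H"

definition join_semilattice_one :: "('a, 'z) hil0_scheme \<Rightarrow> bool" where
  "join_semilattice_one H \<longleftrightarrow>
     closed_op (carrier H) (join H) \<and> one H \<in> carrier H \<and>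
     (\<forall>a\<in>carrier H. \<forall>b\<in>carrier H. \<forall>c\<in>carrier H.
        join H (join H a b) c = join H a (join H b c)) \<and>
     (\<forall>a\<in>carrier H. \<forall>b\<in>carrier H. join H a b = join H b a) \<and>
     (\<forall>a\<in>carrier H. join H a a = a) \<and>
     (\<forall>a\<in>carrier H. join H a (one H) = one H)"

definition hilbert_algebra_sup :: "('a, 'z) hil0_scheme \<Rightarrow> bool" where
  "hilbert_algebra_sup H \<longleftrightarrow>
     hilbert_algebra H \<and> join_semilattice_one H \<and>
     (\<forall>a\<in>carrier H. \<forall>b\<in>carrier H. imp H a b = one H \<longleftrightarrow> join H a b = b)"

definition Hil0 :: "'a hil0 set" where
  "Hil0 = {H. hilbert_algebra_sup H \<and> zero H \<in> carrier H \<and>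
              (\<forall>x\<in>carrier H. hilbert_le H (zero H) x)}"

definition Hey :: "'a hey set" where
  "Hey = {A.
     closed_op (carrier A) (meet A) \<and> closed_op (carrier A) (join A) \<and>
     closed_op (carrier A) (imp A) \<and> zero A \<in> carrier A \<and> one A \<in> carrier A \<and>
     (\<forall>a\<in>carrier A. \<forall>b\<in>carrier A. meet A a b = meet A b a \<and> join A a b = join A b a) \<and>
     (\<forall>a\<in>carrier A. \<forall>b\<in>carrier A. \<forall>c\<in>carrier A.
        meet A (meet A a b) c = meet A a (meet A b c) \<and>
        join A (join A a b) c = join A a (join A b c)) \<and>
     (\<forall>a\<in>carrier A. \<forall>b\<in>carrier A.
        meet A a (join A a b) = a \<and> join A a (meet A a b) = a) \<and>
     (\<forall>a\<in>carrier A. meet A (zero A) a = zero A \<and> meet A a (one A) = a) \<and>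
     (\<forall>a\<in>carrier A. \<forall>b\<in>carrier A. \<forall>c\<in>carrier A.
        meet A (meet A c a) b = meet A c a \<longleftrightarrow> meet A c (imp A a b) = c)}"

text \<open>
  Morphisms are extensional functions (value \<^term>\<open>undefined\<close> off the carrier), so that
  equality of morphisms is equality of functions. Composition is \<^const>\<open>compose\<close> on the
  carrier of the domain; the identity is the restricted identity.
\<close>

definition hil0_hom :: "'a hil0 \<Rightarrow> 'b hil0 \<Rightarrow> ('a \<Rightarrow> 'b) set" where
  "hil0_hom H G = {f \<in> carrier H \<rightarrow>\<^sub>E carrier G.
     (\<forall>a\<in>carrier H. \<forall>b\<in>carrier H. f (join H a b) = join G (f a) (f b)) \<and>
     (\<forall>a\<in>carrier H. \<forall>b\<in>carrier H. f (imp H a b) = imp G (f a) (f b)) \<and>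
     f (zero H) = zero G \<and> f (one H) = one G}"

definition hey_hom :: "'a hey \<Rightarrow> 'b hey \<Rightarrow> ('a \<Rightarrow> 'b) set" where
  "hey_hom A B = {f \<in> carrier A \<rightarrow>\<^sub>E carrier B.
     (\<forall>a\<in>carrier A. \<forall>b\<in>carrier A. f (meet A a b) = meet B (f a) (f b)) \<and>
     (\<forall>a\<in>carrier A. \<forall>b\<in>carrier A. f (join A a b) = join B (f a) (f b)) \<and>
     (\<forall>a\<in>carrier A. \<forall>b\<in>carrier A. f (imp A a b) = imp B (f a) (f b)) \<and>
     f (zero A) = zero B \<and> f (one A) = one B}"

definition ident :: "('a, 'z) hilbert_scheme \<Rightarrow> 'a \<Rightarrow> 'a" where
  "ident H = (\<lambda>x\<in>carrier H. x)"

text \<open>The forgetful functor drops the field \<^const>\<open>meet\<close>; on morphisms it is the identity.\<close>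

definition forget :: "'a hey \<Rightarrow> 'a hil0" where
  "forget A = hil0.truncate A"

definition forget_map :: "('a \<Rightarrow> 'b) \<Rightarrow> 'a \<Rightarrow> 'b" where
  "forget_map g = g"

definition implicative_filter :: "('a, 'z) hilbert_scheme \<Rightarrow> 'a set \<Rightarrow> bool" where
  "implicative_filter H F \<longleftrightarrow>
     F \<subseteq> carrier H \<and> one H \<in> F \<and>
     (\<forall>a\<in>carrier H. \<forall>b\<in>carrier H. a \<in> F \<and> imp H a b \<in> F \<longrightarrow> b \<in> F)"

definition irr_filters :: "('a, 'z) hilbert_scheme \<Rightarrow> 'a set set" where
  "irr_filters H = {F. implicative_filter H F \<and> F \<noteq> carrier H \<and>
     (\<forall>F1 F2. implicative_filter H F1 \<and> implicative_filter H F2 \<and> F = F1 \<inter> F2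
        \<longrightarrow> F = F1 \<or> F = F2)}"

definition phi :: "('a, 'z) hilbert_scheme \<Rightarrow> 'a \<Rightarrow> 'a set set" where
  "phi H a = {P \<in> irr_filters H. a \<in> P}"

definition upsets :: "'a set set \<Rightarrow> 'a set set set" where
  "upsets X = {U. U \<subseteq> X \<and> (\<forall>P\<in>U. \<forall>Q\<in>X. P \<subseteq> Q \<longrightarrow> Q \<in> U)}"

definition downset :: "'a set set \<Rightarrow> 'a set set \<Rightarrow> 'a set set" where
  "downset X Y = {P \<in> X. \<exists>Q\<in>Y. P \<subseteq> Q}"

definition upset_algebra :: "'a set set \<Rightarrow> 'a set set hey" where
  "upset_algebra X =
     \<lparr>carrier = upsets X, imp = (\<lambda>U V. X - downset X (U \<inter> (X - V))), one = X,
      join = (\<union>), zero = {}, meet = (\<inter>)\<rparr>"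

definition hey_subuniverse :: "'a hey \<Rightarrow> 'a set \<Rightarrow> bool" where
  "hey_subuniverse A B \<longleftrightarrow>
     B \<subseteq> carrier A \<and> zero A \<in> B \<and> one A \<in> B \<and>
     closed_op B (meet A) \<and> closed_op B (join A) \<and> closed_op B (imp A)"

definition hey_generated :: "'a hey \<Rightarrow> 'a set \<Rightarrow> 'a hey" where
  "hey_generated A S = A\<lparr>carrier := \<Inter>{B. hey_subuniverse A B \<and> S \<subseteq> B}\<rparr>"

definition hey_of :: "'a hil0 \<Rightarrow> 'a set set hey" where
  "hey_of H = hey_generated (upset_algebra (irr_filters H)) (phi H ` carrier H)"

definition filter_rel :: "'a hil0 \<Rightarrow> 'b hil0 \<Rightarrow> ('a \<Rightarrow> 'b) \<Rightarrow> ('b set \<times> 'a set) set" where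
  "filter_rel H G f =
     {(P, Q). P \<in> irr_filters G \<and> Q \<in> irr_filters H \<and> {a \<in> carrier H. f a \<in> P} \<subseteq> Q}"

definition hey_of_map ::
  "'a hil0 \<Rightarrow> 'b hil0 \<Rightarrow> ('a \<Rightarrow> 'b) \<Rightarrow> 'a set set \<Rightarrow> 'b set set" where
  "hey_of_map H G f =
     (\<lambda>U\<in>carrier (hey_of H). {P \<in> irr_filters G. filter_rel H G f `` {P} \<subseteq> U})"

text \<open>
  The comparison map of hom-sets has an explicit definition, precomposition with the unit
  \<^term>\<open>phi H\<close>, because \<^const>\<open>hey_of\<close> changes the type of elements: an existentially quantified
  family of bijections would be tied to one fixed choice of types, a constant is polymorphic.
\<close>

definition transpose_map :: "'a hil0 \<Rightarrow> ('a set set \<Rightarrow> 'b) \<Rightarrow> 'a \<Rightarrow> 'b" where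
  "transpose_map H g = compose (carrier H) (forget_map g) (phi H)"

end

theory Submission
  imports Defs
begin

text \<open>
  The free Heyting algebra over \<open>H\<close> is generated by a copy of \<open>H\<close> among the upsets of irreducible
  filters. What makes this work is that suprema turn irreducibility into primeness: a
  filter is irreducible iff it is proper and
  \<open>a \<or> b \<in> P\<close> forces \<open>a \<in> P\<close> or \<open>b \<in> P\<close> (\<open>irr_filter_prime\<close>, \<open>prime_imp_irr\<close>). Consequently \<^const>\<open>phi\<close>
  is an embedding that preserves \<open>\<or>\<close>, \<open>\<rightarrow>\<close>, \<open>0\<close> and \<open>1\<close>; it is the unit of the adjunction.

  For the same reason the preimage of an irreducible filter under a homomorphism \<open>f\<close> is irreducible.
  It is then the least element of \<open>R_f(P)\<close>, so on upsets \<open>hey_of_map f\<close> is nothing but inverse image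
  along the monotone map \<open>P \<mapsto> f\<inverse>(P)\<close> (\<open>hey_of_map_eq\<close>). Inverse images preserve unions and
  intersections. They also preserve Heyting implication as soon as the map is a p-morphism, and
  \<open>vimage_lifting\<close> shows that it is one: if \<open>f\<inverse>(P) \<subseteq> Q\<close>, a filter \<open>M \<supseteq> P\<close> that is maximal among those
  missing \<open>f[H - Q]\<close> satisfies \<open>f\<inverse>(M) = Q\<close>. Since moreover \<open>hey_of_map f \<circ> phi = phi \<circ> f\<close>, generators go to
  generators, and \<open>hey_of_map f\<close> restricts to the generated subalgebras.

  Homomorphisms out of a generated algebra are determined on the generators, which gives
  functoriality and the injectivity of \<^const>\<open>transpose_map\<close>. For surjectivity, let \<open>A\<close> be a Heyting
  algebra and \<open>f : H \<rightarrow> U A\<close>. Implicative filters of \<open>A\<close> are closed under \<open>\<and>\<close>, so \<^const>\<open>phi\<close> preserves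
  \<open>\<and>\<close> too; hence \<open>phi[A]\<close> is already a Heyting subalgebra and \<^const>\<open>phi\<close> is an
  isomorphism from \<open>A\<close> onto \<open>hey_of (U A)\<close> (\<open>phi_forget_iso\<close>). Its
  inverse, the counit, composed with \<open>hey_of_map f\<close> is the required extension of \<open>f\<close>.
\<close>

section \<open>Algebras of upsets\<close>

lemma upset_algebra_simps [simp]:
  "carrier (upset_algebra X) = upsets X" "one (upset_algebra X) = X"
  "join (upset_algebra X) = (\<union>)" "zero (upset_algebra X) = {}" "meet (upset_algebra X) = (\<inter>)"
  "imp (upset_algebra X) U V = X - downset X (U \<inter> (X - V))"
  by (simp_all add: upset_algebra_def)

text \<open>
  The form in which Heyting implication of upsets is used below: Kripke's forcing clause.
\<close>

lemma upset_imp_iff: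
  "P \<in> X - downset X (U \<inter> (X - V)) \<longleftrightarrow>
    P \<in> X \<and> (\<forall>Q\<in>X. P \<subseteq> Q \<longrightarrow> Q \<in> U \<longrightarrow> Q \<in> V)"
  unfolding downset_def by auto

lemma upset_imp_upset: "X - downset X Y \<in> upsets X"
proof -
  have "Q \<in> X - downset X Y" if "P \<in> X - downset X Y" "Q \<in> X" "P \<subseteq> Q" for P Q
    using that unfolding downset_def by auto
  then show ?thesis unfolding upsets_def by auto
qed

lemma upset_residuation:
  assumes W: "W \<in> upsets X"
  shows "W \<inter> U \<inter> V = W \<inter> U \<longleftrightarrow> W \<inter> (X - downset X (U \<inter> (X - V))) = W"
proof -
  have WX: "W \<subseteq> X" and up: "\<And>P Q. P \<in> W \<Longrightarrow> Q \<in> X \<Longrightarrow> P \<subseteq> Q \<Longrightarrow> Q \<in> W"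
    using W unfolding upsets_def by auto
  have "W \<inter> U \<inter> V = W \<inter> U \<longleftrightarrow> (\<forall>P\<in>W. P \<in> U \<longrightarrow> P \<in> V)" by auto
  also have "\<dots> \<longleftrightarrow> (\<forall>P\<in>W. P \<in> X \<and> (\<forall>Q\<in>X. P \<subseteq> Q \<longrightarrow> Q \<in> U \<longrightarrow> Q \<in> V))"
    using up WX by (meson subset_refl subsetD)
  also have "\<dots> \<longleftrightarrow> W \<subseteq> X - downset X (U \<inter> (X - V))"
    unfolding subset_eq[of W] upset_imp_iff ..
  finally show ?thesis unfolding le_iff_inf .
qed

lemma upset_algebra_Hey: "upset_algebra X \<in> Hey"
proof -
  have "U \<inter> V \<in> upsets X" "U \<union> V \<in> upsets X" if "U \<in> upsets X" "V \<in> upsets X" for U V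
    using that unfolding upsets_def by auto
  moreover have "{} \<in> upsets X" "X \<in> upsets X" unfolding upsets_def by auto
  moreover have "U \<inter> X = U" if "U \<in> upsets X" for U using that unfolding upsets_def by auto
  ultimately show ?thesis
    unfolding Hey_def closed_op_def mem_Collect_eq upset_algebra_simps
    by (intro conjI ballI upset_residuation upset_imp_upset) auto
qed

section \<open>Implicative filters of Hilbert algebras\<close>

text \<open>
  For a filter \<open>F\<close> this is the filter generated by \<open>F \<union> {a}\<close>; the defining formula is the deduction
  theorem.
\<close>

definition adjoin :: "('a, 'z) hilbert_scheme \<Rightarrow> 'a set \<Rightarrow> 'a \<Rightarrow> 'a set" where
  "adjoin H F a = {c \<in> carrier H. imp H a c \<in> F}"

lemma filter_mp:
  assumes "implicative_filter H F" "a \<in> F" "imp H a b \<in> F" "b \<in> carrier H"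
  shows "b \<in> F"
  using assms unfolding implicative_filter_def by blast

lemma filter_one: "implicative_filter H F \<Longrightarrow> one H \<in> F"
  and filter_subset: "implicative_filter H F \<Longrightarrow> F \<subseteq> carrier H"
  unfolding implicative_filter_def by blast+

lemma filter_up:
  assumes "implicative_filter H F" "a \<in> F" "imp H a b = one H" "b \<in> carrier H"
  shows "b \<in> F"
  using filter_mp[OF assms(1,2) _ assms(4)] filter_one[OF assms(1)] assms(3) by simp

lemma implicative_filter_Union_chain:
  assumes "C0 \<in> C" and filters: "\<And>F. F \<in> C \<Longrightarrow> implicative_filter H F"
    and chain: "\<And>X Y. X \<in> C \<Longrightarrow> Y \<in> C \<Longrightarrow> X \<subseteq> Y \<or> Y \<subseteq> X"
  shows "implicative_filter H (\<Union>C)"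
  unfolding implicative_filter_def
proof (intro conjI ballI impI)
  show "\<Union>C \<subseteq> carrier H" using filter_subset[OF filters] by blast
  show "one H \<in> \<Union>C" using assms(1) filter_one[OF filters] by blast
next
  fix a b assume b: "b \<in> carrier H" and "a \<in> \<Union>C \<and> imp H a b \<in> \<Union>C"
  then obtain X Y where XY: "X \<in> C" "a \<in> X" "Y \<in> C" "imp H a b \<in> Y" by blast
  then obtain Z where Z: "Z \<in> C" "a \<in> Z" "imp H a b \<in> Z" using chain[OF XY(1,3)] by blast
  then have "b \<in> Z" using filter_mp[OF filters[OF Z(1)] Z(2,3) b] by blast
  then show "b \<in> \<Union>C" using Z(1) by blast
qed

lemma irr_filterI:
  assumes "implicative_filter H P" "P \<noteq> carrier H"
    and "\<And>F1 F2. implicative_filter H F1 \<Longrightarrow> implicative_filter H F2 \<Longrightarrow> P = F1 \<inter> F2 \<Longrightarrow>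
      P = F1 \<or> P = F2"
  shows "P \<in> irr_filters H"
  unfolding irr_filters_def mem_Collect_eq
  by (intro conjI allI impI, (rule assms(1,2))+, (elim conjE, rule assms(3)))

lemma irr_filterD:
  assumes "P \<in> irr_filters H"
  shows "implicative_filter H P" "P \<noteq> carrier H" "P \<subseteq> carrier H"
proof -
  note irr = assms[unfolded irr_filters_def mem_Collect_eq]
  show F: "implicative_filter H P" by (rule irr[THEN conjunct1])
  show "P \<noteq> carrier H" by (rule irr[THEN conjunct2, THEN conjunct1])
  show "P \<subseteq> carrier H" by (rule filter_subset[OF F])
qed

context
  fixes H :: "('a, 'z) hilbert_scheme"
  assumes hilb: "hilbert_algebra H"
begin

lemma imp_closed: "a \<in> carrier H \<Longrightarrow> b \<in> carrier H \<Longrightarrow> imp H a b \<in> carrier H"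
  and one_closed: "one H \<in> carrier H"
  using hilb unfolding hilbert_algebra_def closed_op_def by blast+

lemma imp_K: "a \<in> carrier H \<Longrightarrow> b \<in> carrier H \<Longrightarrow> imp H a (imp H b a) = one H"
  using hilb unfolding hilbert_algebra_def by blast

lemma imp_S: "a \<in> carrier H \<Longrightarrow> b \<in> carrier H \<Longrightarrow> c \<in> carrier H \<Longrightarrow>
    imp H (imp H a (imp H b c)) (imp H (imp H a b) (imp H a c)) = one H"
  using hilb unfolding hilbert_algebra_def by blast

lemma imp_antisym: "a \<in> carrier H \<Longrightarrow> b \<in> carrier H \<Longrightarrow>
    imp H a b = one H \<Longrightarrow> imp H b a = one H \<Longrightarrow> a = b"
  using hilb unfolding hilbert_algebra_def by blast

lemma imp_one: assumes "a \<in> carrier H" shows "imp H a (one H) = one H"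
proof (rule imp_antisym)
  show "imp H (one H) (imp H a (one H)) = one H"
    using assms imp_K one_closed by blast
  \<comment> \<open>now \<open>one H\<close> has the form \<open>1 \<rightarrow> x\<close> for \<open>x = a \<rightarrow> 1\<close>, so \<open>x \<rightarrow> 1\<close> is an instance of \<open>x \<rightarrow> (1 \<rightarrow> x)\<close>\<close>
  then show "imp H (imp H a (one H)) (one H) = one H"
    using assms imp_K[of "imp H a (one H)" "one H"] one_closed imp_closed by simp
qed (use assms one_closed imp_closed in auto)

text \<open>
  Membership in the trivial filter means equality with \<open>1\<close>, so identities \<open>a \<rightarrow> (b \<rightarrow> c) = 1\<close> can be
  proved by adjoining \<open>a\<close> and \<open>b\<close> to it and deriving \<open>c\<close> by modus ponens.
\<close>

lemma implicative_filter_one: "implicative_filter H {one H}"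
  unfolding implicative_filter_def
  using imp_antisym[OF _ one_closed] imp_one one_closed by auto

lemma implicative_filter_adjoin:
  assumes F: "implicative_filter H F" and a: "a \<in> carrier H"
  shows "implicative_filter H (adjoin H F a)"
  unfolding implicative_filter_def
proof (intro conjI ballI impI)
  show "one H \<in> adjoin H F a"
    using a F by (simp add: adjoin_def imp_one one_closed filter_one)
next
  fix c d assume cd: "c \<in> carrier H" "d \<in> carrier H"
    and "c \<in> adjoin H F a \<and> imp H c d \<in> adjoin H F a"
  then have 1: "imp H a c \<in> F" and 2: "imp H a (imp H c d) \<in> F"
    unfolding adjoin_def by auto
  have "imp H (imp H a c) (imp H a d) \<in> F"
    using filter_up[OF F 2 imp_S[OF a cd]] a cd imp_closed by blast
  then show "d \<in> adjoin H F a"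
    using filter_mp[OF F 1] a cd imp_closed unfolding adjoin_def by blast
qed (auto simp: adjoin_def)

lemma subset_adjoin:
  assumes F: "implicative_filter H F" and a: "a \<in> carrier H"
  shows "F \<subseteq> adjoin H F a"
proof
  fix b assume b: "b \<in> F"
  then have bH: "b \<in> carrier H" using filter_subset[OF F] by blast
  then have "imp H a b \<in> F"
    using filter_up[OF F b imp_K[OF bH a]] a imp_closed by simp
  then show "b \<in> adjoin H F a" using bH unfolding adjoin_def by simp
qed

text \<open>
  The derivation of \<open>a \<rightarrow> a\<close> from the axioms K and S.
\<close>

lemma mem_adjoin:
  assumes F: "implicative_filter H F" and a: "a \<in> carrier H"
  shows "a \<in> adjoin H F a"
proof -
  let ?i = "imp H a a"
  have i: "?i \<in> carrier H" using a imp_closed by blast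
  have 1: "imp H a (imp H ?i a) \<in> F" "imp H a ?i \<in> F"
    using imp_K[OF a i] imp_K[OF a a] filter_one[OF F] by auto
  have "imp H (imp H a ?i) ?i \<in> F"
    using filter_up[OF F 1(1) imp_S[OF a i a]] a i imp_closed by blast
  then have "?i \<in> F" using filter_mp[OF F 1(2)] i by blast
  then show ?thesis using a unfolding adjoin_def by blast
qed

end

section \<open>Irreducible filters in the presence of suprema\<close>

context
  fixes H :: "('a, 'z) hil0_scheme"
  assumes sup: "hilbert_algebra_sup H"
begin

lemma sup_hilbert: "hilbert_algebra H"
  using sup unfolding hilbert_algebra_sup_def by blast

lemma join_closed: "a \<in> carrier H \<Longrightarrow> b \<in> carrier H \<Longrightarrow> join H a b \<in> carrier H"
  using sup unfolding hilbert_algebra_sup_def join_semilattice_one_def closed_op_def by blast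

lemma le_iff_join: "a \<in> carrier H \<Longrightarrow> b \<in> carrier H \<Longrightarrow> imp H a b = one H \<longleftrightarrow> join H a b = b"
  using sup unfolding hilbert_algebra_sup_def by blast

lemma join_laws:
  "a \<in> carrier H \<Longrightarrow> b \<in> carrier H \<Longrightarrow> c \<in> carrier H \<Longrightarrow>
     join H (join H a b) c = join H a (join H b c)"
  "a \<in> carrier H \<Longrightarrow> b \<in> carrier H \<Longrightarrow> join H a b = join H b a"
  "a \<in> carrier H \<Longrightarrow> join H a a = a"
  using sup unfolding hilbert_algebra_sup_def join_semilattice_one_def by blast+

lemma join_upper1:
  assumes "a \<in> carrier H" "b \<in> carrier H" shows "imp H a (join H a b) = one H"
  using assms join_laws(1)[of a a b] by (simp add: le_iff_join join_closed join_laws(3))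

lemma join_upper2:
  assumes "a \<in> carrier H" "b \<in> carrier H" shows "imp H b (join H a b) = one H"
  using assms join_upper1[of b a] join_laws(2)[of a b] by simp

lemma join_least:
  assumes "a \<in> carrier H" "b \<in> carrier H" "d \<in> carrier H"
    and "imp H a d = one H" "imp H b d = one H"
  shows "imp H (join H a b) d = one H"
  using assms by (simp add: le_iff_join join_closed join_laws(1))

lemma filter_joinI:
  assumes "implicative_filter H F" "a \<in> carrier H" "b \<in> carrier H" "a \<in> F \<or> b \<in> F"
  shows "join H a b \<in> F"
  using assms(4) filter_up[OF assms(1) _ join_upper1[OF assms(2,3)]]
    filter_up[OF assms(1) _ join_upper2[OF assms(2,3)]] join_closed[OF assms(2,3)] by blast

text \<open>
  Disjunction elimination. The order-theoretic supremum is enough for it, since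
  \<open>d = (a \<rightarrow> c) \<rightarrow> ((b \<rightarrow> c) \<rightarrow> c)\<close> is an upper bound of \<open>a\<close> and \<open>b\<close>, hence of \<open>a \<or> b\<close>.
\<close>

lemma filter_case_split:
  assumes F: "implicative_filter H F"
    and a: "a \<in> carrier H" and b: "b \<in> carrier H" and c: "c \<in> carrier H"
    and ac: "imp H a c \<in> F" and bc: "imp H b c \<in> F"
  shows "imp H (join H a b) c \<in> F"
proof -
  note hilb = sup_hilbert
  let ?x = "imp H a c" and ?y = "imp H b c"
  let ?d = "imp H ?x (imp H ?y c)"
  have x: "?x \<in> carrier H" and y: "?y \<in> carrier H" using a b c imp_closed[OF hilb] by auto
  have yc: "imp H ?y c \<in> carrier H" using y c imp_closed[OF hilb] by auto
  have d: "?d \<in> carrier H" using x yc imp_closed[OF hilb] by auto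
  have ab: "join H a b \<in> carrier H" using a b by (rule join_closed)
  have below: "imp H e ?d = one H"
    if e: "e \<in> carrier H" and ec: "imp H e c = ?x \<or> imp H e c = ?y" for e
  proof -
    \<comment> \<open>adjoining \<open>e\<close>, \<open>?x\<close>, \<open>?y\<close> to the trivial filter in turn, \<open>c\<close> follows by modus ponens\<close>
    define F1 where "F1 = adjoin H {one H} e"
    define F2 where "F2 = adjoin H F1 ?x"
    define F3 where "F3 = adjoin H F2 ?y"
    note T = implicative_filter_one[OF hilb]
    have F1: "implicative_filter H F1" "e \<in> F1"
      unfolding F1_def by (rule implicative_filter_adjoin[OF hilb T e] mem_adjoin[OF hilb T e])+
    have F2: "implicative_filter H F2" "F1 \<subseteq> F2" "?x \<in> F2"
      unfolding F2_def
      by (rule implicative_filter_adjoin[OF hilb F1(1) x] subset_adjoin[OF hilb F1(1) x]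
          mem_adjoin[OF hilb F1(1) x])+
    have F3: "implicative_filter H F3" "F2 \<subseteq> F3" "?y \<in> F3"
      unfolding F3_def
      by (rule implicative_filter_adjoin[OF hilb F2(1) y] subset_adjoin[OF hilb F2(1) y]
          mem_adjoin[OF hilb F2(1) y])+
    have "e \<in> F3" using F1(2) F2(2) F3(2) by blast
    moreover have "imp H e c \<in> F3" using ec F2(3) F3(2,3) by auto
    ultimately have "c \<in> F3" using filter_mp[OF F3(1)] c by blast
    then show ?thesis unfolding F1_def F2_def F3_def adjoin_def by blast
  qed
  have ab_d: "imp H (join H a b) ?d = one H"
    by (rule join_least[OF a b d below[OF a] below[OF b]]) simp_all
  let ?G = "adjoin H F (join H a b)"
  have G: "implicative_filter H ?G" "F \<subseteq> ?G" "join H a b \<in> ?G"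
    by (rule implicative_filter_adjoin[OF hilb F ab] subset_adjoin[OF hilb F ab]
        mem_adjoin[OF hilb F ab])+
  have "?d \<in> ?G" by (rule filter_up[OF G(1,3) ab_d d])
  then have "imp H ?y c \<in> ?G" by (rule filter_mp[OF G(1) subsetD[OF G(2) ac] _ yc])
  then have "c \<in> ?G" by (rule filter_mp[OF G(1) subsetD[OF G(2) bc] _ c])
  then show ?thesis unfolding adjoin_def by blast
qed

text \<open>
  If \<open>a \<or> b \<in> P\<close>, disjunction elimination says that whatever follows both from \<open>P, a\<close> and from
  \<open>P, b\<close> lies in \<open>P\<close>. So \<open>P\<close> is the intersection of the two extensions, and irreducibility makes one of
  them equal to \<open>P\<close>.
\<close>

lemma irr_filter_prime:
  assumes P: "P \<in> irr_filters H" and a: "a \<in> carrier H" and b: "b \<in> carrier H"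
    and ab: "join H a b \<in> P"
  shows "a \<in> P \<or> b \<in> P"
proof -
  note hilb = sup_hilbert
  note F = irr_filterD(1)[OF P]
  have "adjoin H P a \<inter> adjoin H P b \<subseteq> P"
    using filter_case_split[OF F a b] filter_mp[OF F ab] unfolding adjoin_def by blast
  then have "P = adjoin H P a \<inter> adjoin H P b"
    using subset_adjoin[OF hilb F a] subset_adjoin[OF hilb F b] by blast
  then have "P = adjoin H P a \<or> P = adjoin H P b"
    using P implicative_filter_adjoin[OF hilb F a] implicative_filter_adjoin[OF hilb F b]
    unfolding irr_filters_def by blast
  then show ?thesis
    using mem_adjoin[OF hilb F a] mem_adjoin[OF hilb F b] by blast
qed

lemma irr_filter_join_iff:
  assumes "P \<in> irr_filters H" "a \<in> carrier H" "b \<in> carrier H"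
  shows "join H a b \<in> P \<longleftrightarrow> a \<in> P \<or> b \<in> P"
  using assms irr_filter_prime filter_joinI irr_filterD(1) by blast

lemma prime_imp_irr:
  assumes F: "implicative_filter H F" and proper: "F \<noteq> carrier H"
    and prime: "\<And>a b. a \<in> carrier H \<Longrightarrow> b \<in> carrier H \<Longrightarrow> join H a b \<in> F \<Longrightarrow> a \<in> F \<or> b \<in> F"
  shows "F \<in> irr_filters H"
proof (rule irr_filterI[OF F proper])
  fix F1 F2 assume F12: "implicative_filter H F1" "implicative_filter H F2" and eq: "F = F1 \<inter> F2"
  show "F = F1 \<or> F = F2"
  proof (rule ccontr)
    assume "\<not> (F = F1 \<or> F = F2)"
    then obtain a b where ab: "a \<in> F1" "a \<notin> F" "b \<in> F2" "b \<notin> F" using eq by blast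
    then have "a \<in> carrier H" "b \<in> carrier H" using F12 filter_subset by blast+
    moreover from this have "join H a b \<in> F"
      using filter_joinI F12 ab eq by blast
    ultimately show False using prime ab by blast
  qed
qed

text \<open>
  The prime filter theorem, by Zorn's lemma. If a maximal \<open>M\<close> were the intersection of two larger
  filters, both would meet \<open>I\<close>; the join of the two witnesses would then lie in \<open>M \<inter> I\<close>. The sets
  \<open>I\<close> of interest are singletons and images \<open>f[H - Q]\<close> of complements of prime filters. Maximality is part of the conclusion because \<open>vimage_lifting\<close> exploits it.
\<close>

lemma maximal_disjoint_filter:
  assumes F: "implicative_filter H F"
    and I: "I \<subseteq> carrier H" "I \<noteq> {}" "\<And>a b. a \<in> I \<Longrightarrow> b \<in> I \<Longrightarrow> join H a b \<in> I"
    and disj: "F \<inter> I = {}"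
  obtains M where "M \<in> irr_filters H" "F \<subseteq> M" "M \<inter> I = {}"
    "\<And>N. implicative_filter H N \<Longrightarrow> M \<subseteq> N \<Longrightarrow> N \<inter> I = {} \<Longrightarrow> N = M"
proof -
  let ?A = "{M. implicative_filter H M \<and> F \<subseteq> M \<and> M \<inter> I = {}}"
  have "\<exists>M\<in>?A. \<forall>X\<in>?A. M \<subseteq> X \<longrightarrow> X = M"
  proof (rule subset_Zorn_nonempty)
    show "?A \<noteq> {}" using F disj by blast
  next
    fix C assume "C \<noteq> {}" and C: "subset.chain ?A C"
    then obtain C0 where C0: "C0 \<in> C" by blast
    have sub: "C \<subseteq> ?A" and lin: "\<And>X Y. X \<in> C \<Longrightarrow> Y \<in> C \<Longrightarrow> X \<subseteq> Y \<or> Y \<subseteq> X"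
      using C unfolding subset_chain_def by blast+
    have "implicative_filter H (\<Union>C)"
      by (rule implicative_filter_Union_chain[OF C0 _ lin]) (use sub in blast)
    moreover have "F \<subseteq> \<Union>C" using C0 sub by blast
    moreover have "\<Union>C \<inter> I = {}" using sub by blast
    ultimately show "\<Union>C \<in> ?A" by blast
  qed
  then obtain M where MA: "M \<in> ?A" and MX: "\<forall>X\<in>?A. M \<subseteq> X \<longrightarrow> X = M" by (rule bexE)
  have M: "implicative_filter H M" "F \<subseteq> M" "M \<inter> I = {}" using MA by simp_all
  have max: "N = M" if "implicative_filter H N" "F \<subseteq> N" "N \<inter> I = {}" "M \<subseteq> N" for N
    using MX that by simp
  have "M \<in> irr_filters H"
  proof (rule irr_filterI[OF M(1)])
    show "M \<noteq> carrier H" using M(3) I(1,2) by blast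
    fix F1 F2 assume F12: "implicative_filter H F1" "implicative_filter H F2" and eq: "M = F1 \<inter> F2"
    then have FF: "F \<subseteq> F1" "F \<subseteq> F2" "M \<subseteq> F1" "M \<subseteq> F2" using M(2) by blast+
    show "M = F1 \<or> M = F2"
    proof (rule ccontr)
      assume "\<not> (M = F1 \<or> M = F2)"
      then have "F1 \<inter> I \<noteq> {}" "F2 \<inter> I \<noteq> {}"
        using max[OF F12(1) FF(1) _ FF(3)] max[OF F12(2) FF(2) _ FF(4)] by blast+
      then obtain a b where ab: "a \<in> F1" "a \<in> I" "b \<in> F2" "b \<in> I" by blast
      then have abH: "a \<in> carrier H" "b \<in> carrier H" using I(1) by blast+
      have "join H a b \<in> F1" "join H a b \<in> F2"
        using filter_joinI[OF F12(1) abH] filter_joinI[OF F12(2) abH] ab by simp_all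
      then show False using I(3)[OF ab(2,4)] eq M(3) by blast
    qed
  qed
  moreover have "N = M" if "implicative_filter H N" "M \<subseteq> N" "N \<inter> I = {}" for N
    by (rule max[OF that(1) subset_trans[OF M(2) that(2)] that(3,2)])
  ultimately show thesis by (intro that[OF _ M(2,3)])
qed

lemma irr_filter_avoiding:
  assumes F: "implicative_filter H F" and b: "b \<in> carrier H" "b \<notin> F"
  obtains P where "P \<in> irr_filters H" "F \<subseteq> P" "b \<notin> P"
proof (rule maximal_disjoint_filter[OF F, of "{b}"])
  show "join H x y \<in> {b}" if "x \<in> {b}" "y \<in> {b}" for x y
    using that join_laws(3)[OF b(1)] by simp
  fix M assume M: "M \<in> irr_filters H" "F \<subseteq> M" "M \<inter> {b} = {}"
  then have "b \<notin> M" by blast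
  then show thesis by (rule that[OF M(1,2)])
qed (use b in auto)

section \<open>The representation map\<close>

lemma phi_join:
  assumes "a \<in> carrier H" "b \<in> carrier H"
  shows "phi H (join H a b) = phi H a \<union> phi H b"
  using irr_filter_join_iff[OF _ assms] unfolding phi_def by auto

lemma phi_one: "phi H (one H) = irr_filters H"
  using filter_one[OF irr_filterD(1)] unfolding phi_def by auto

text \<open>
  If \<open>a \<rightarrow> b \<notin> P\<close>, then \<open>b\<close> is outside the filter generated by \<open>P\<close> and \<open>a\<close>, and an irreducible filter
  above the latter that avoids \<open>b\<close> refutes the implication at \<open>P\<close>.
\<close>

lemma phi_imp:
  assumes a: "a \<in> carrier H" and b: "b \<in> carrier H"
  shows "phi H (imp H a b) =
    irr_filters H - downset (irr_filters H) (phi H a \<inter> (irr_filters H - phi H b))"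
proof -
  note hilb = sup_hilbert
  have iff: "imp H a b \<in> P \<longleftrightarrow> (\<forall>Q\<in>irr_filters H. P \<subseteq> Q \<longrightarrow> a \<in> Q \<longrightarrow> b \<in> Q)"
    if P: "P \<in> irr_filters H" for P
  proof
    assume *: "imp H a b \<in> P"
    show "\<forall>Q\<in>irr_filters H. P \<subseteq> Q \<longrightarrow> a \<in> Q \<longrightarrow> b \<in> Q"
    proof (intro ballI impI)
      fix Q assume Q: "Q \<in> irr_filters H" "P \<subseteq> Q" "a \<in> Q"
      show "b \<in> Q" by (rule filter_mp[OF irr_filterD(1)[OF Q(1)] Q(3) subsetD[OF Q(2) *] b])
    qed
  next
    note F = irr_filterD(1)[OF P]
    assume *: "\<forall>Q\<in>irr_filters H. P \<subseteq> Q \<longrightarrow> a \<in> Q \<longrightarrow> b \<in> Q"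
    have "b \<in> adjoin H P a"
    proof (rule ccontr)
      assume "b \<notin> adjoin H P a"
      then obtain Q where Q: "Q \<in> irr_filters H" "adjoin H P a \<subseteq> Q" "b \<notin> Q"
        by (rule irr_filter_avoiding[OF implicative_filter_adjoin[OF hilb F a] b])
      moreover have "P \<subseteq> Q" "a \<in> Q"
        using subset_adjoin[OF hilb F a] mem_adjoin[OF hilb F a] Q(2) by auto
      ultimately show False using * by simp
    qed
    then show "imp H a b \<in> P" unfolding adjoin_def by simp
  qed
  show ?thesis
  proof (rule set_eqI)
    fix P
    show "P \<in> phi H (imp H a b) \<longleftrightarrow>
        P \<in> irr_filters H - downset (irr_filters H) (phi H a \<inter> (irr_filters H - phi H b))"
      unfolding upset_imp_iff using iff[of P] unfolding phi_def by auto
  qed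
qed

lemma phi_inj: "inj_on (phi H) (carrier H)"
proof (rule inj_onI)
  note hilb = sup_hilbert
  have le: "imp H a b = one H"
    if a: "a \<in> carrier H" and b: "b \<in> carrier H" and eq: "phi H a = phi H b" for a b
  proof (rule ccontr)
    assume "imp H a b \<noteq> one H"
    then have "imp H a b \<notin> {one H}" by simp
    then obtain P where P: "P \<in> irr_filters H" "imp H a b \<notin> P"
      by (rule irr_filter_avoiding[OF implicative_filter_one[OF hilb] imp_closed[OF hilb a b]])
    have "P \<in> phi H (imp H a b)"
      unfolding phi_imp[OF a b] eq downset_def using P(1) by simp
    then show False using P(2) unfolding phi_def by simp
  qed
  fix a b assume ab: "a \<in> carrier H" "b \<in> carrier H" "phi H a = phi H b"
  show "a = b"
    by (rule imp_antisym[OF hilb ab(1,2) le[OF ab] le[OF ab(2,1) ab(3)[symmetric]]])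
qed

end

lemma Hil0D:
  assumes "H \<in> Hil0"
  shows "hilbert_algebra_sup H" "hilbert_algebra H" "zero H \<in> carrier H"
    "\<And>x. x \<in> carrier H \<Longrightarrow> imp H (zero H) x = one H"
  using assms unfolding Hil0_def hilbert_algebra_sup_def hilbert_le_def by auto

lemma zero_notin_irr:
  assumes "H \<in> Hil0" "P \<in> irr_filters H"
  shows "zero H \<notin> P"
proof
  assume "zero H \<in> P"
  then have "carrier H \<subseteq> P"
    using filter_up[OF irr_filterD(1)[OF assms(2)]] Hil0D(4)[OF assms(1)] by blast
  then show False using irr_filterD(2,3)[OF assms(2)] by blast
qed

lemma phi_zero: "H \<in> Hil0 \<Longrightarrow> phi H (zero H) = {}"
  using zero_notin_irr unfolding phi_def by blast

section \<open>Heyting algebras\<close>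

context
  fixes A :: "'a hey"
  assumes A: "A \<in> Hey"
begin

lemma Hey_closed:
  "a \<in> carrier A \<Longrightarrow> b \<in> carrier A \<Longrightarrow> meet A a b \<in> carrier A"
  "a \<in> carrier A \<Longrightarrow> b \<in> carrier A \<Longrightarrow> join A a b \<in> carrier A"
  "a \<in> carrier A \<Longrightarrow> b \<in> carrier A \<Longrightarrow> imp A a b \<in> carrier A"
  "zero A \<in> carrier A" "one A \<in> carrier A"
  using A unfolding Hey_def closed_op_def by blast+

lemma Hey_laws:
  "a \<in> carrier A \<Longrightarrow> b \<in> carrier A \<Longrightarrow> meet A a b = meet A b a"
  "a \<in> carrier A \<Longrightarrow> b \<in> carrier A \<Longrightarrow> join A a b = join A b a"
  "a \<in> carrier A \<Longrightarrow> b \<in> carrier A \<Longrightarrow> c \<in> carrier A \<Longrightarrow>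
     meet A (meet A a b) c = meet A a (meet A b c)"
  "a \<in> carrier A \<Longrightarrow> b \<in> carrier A \<Longrightarrow> c \<in> carrier A \<Longrightarrow>
     join A (join A a b) c = join A a (join A b c)"
  "a \<in> carrier A \<Longrightarrow> b \<in> carrier A \<Longrightarrow> meet A a (join A a b) = a"
  "a \<in> carrier A \<Longrightarrow> b \<in> carrier A \<Longrightarrow> join A a (meet A a b) = a"
  "a \<in> carrier A \<Longrightarrow> meet A (zero A) a = zero A"
  "a \<in> carrier A \<Longrightarrow> meet A a (one A) = a"
  "a \<in> carrier A \<Longrightarrow> b \<in> carrier A \<Longrightarrow> c \<in> carrier A \<Longrightarrow>
     meet A (meet A c a) b = meet A c a \<longleftrightarrow> meet A c (imp A a b) = c"
  using A unfolding Hey_def by blast+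

lemma Hey_meet_idem: "a \<in> carrier A \<Longrightarrow> meet A a a = a"
  using Hey_laws(5,6) Hey_closed by metis

lemma Hey_join_idem: "a \<in> carrier A \<Longrightarrow> join A a a = a"
  using Hey_laws(5,6) Hey_closed by metis

lemma Hey_imp_one_iff:
  assumes "a \<in> carrier A" "b \<in> carrier A"
  shows "imp A a b = one A \<longleftrightarrow> meet A a b = a"
  using Hey_laws(9)[OF assms Hey_closed(5)] Hey_laws(1,8) assms Hey_closed(3,5) by metis

lemma Hey_meet_join_iff:
  assumes "a \<in> carrier A" "b \<in> carrier A"
  shows "meet A a b = a \<longleftrightarrow> join A a b = b"
  using assms Hey_laws(1,2,5,6) by metis

lemma Hey_meet_left_le:
  assumes "a \<in> carrier A" "b \<in> carrier A"
  shows "meet A (meet A a b) a = meet A a b" "meet A (meet A b a) a = meet A b a"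
proof -
  show 2: "meet A (meet A b a) a = meet A b a"
    using assms Hey_laws(3)[of b a a] Hey_meet_idem by simp
  show "meet A (meet A a b) a = meet A a b"
    using 2 Hey_laws(1)[OF assms] by simp
qed

lemma Hey_le_trans:
  assumes "a \<in> carrier A" "b \<in> carrier A" "c \<in> carrier A" "meet A a b = a" "meet A b c = b"
  shows "meet A a c = a"
  using assms Hey_laws(3) by metis

lemma Hey_mp:
  assumes c: "c \<in> carrier A" "a \<in> carrier A" "b \<in> carrier A"
    and "meet A c a = c" "meet A c (imp A a b) = c"
  shows "meet A c b = c"
  using assms Hey_laws(9) by metis

lemma Hey_imp_K:
  assumes "a \<in> carrier A" "b \<in> carrier A"
  shows "imp A a (imp A b a) = one A"
  using assms Hey_imp_one_iff Hey_laws(9) Hey_meet_left_le Hey_closed by metis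

text \<open>
  Both implications on the right residuate, so it suffices that the meet \<open>m\<close> of \<open>a \<rightarrow> (b \<rightarrow> c)\<close>, \<open>a \<rightarrow> b\<close> and \<open>a\<close> is
  below \<open>c\<close>, and this is three applications of modus ponens below \<open>m\<close>.
\<close>

lemma Hey_imp_S:
  assumes [simp]: "a \<in> carrier A" "b \<in> carrier A" "c \<in> carrier A"
  shows "imp A (imp A a (imp A b c)) (imp A (imp A a b) (imp A a c)) = one A"
proof -
  note [simp] = Hey_closed
  let ?x = "imp A a (imp A b c)" and ?y = "imp A a b"
  let ?m = "meet A (meet A ?x ?y) a"
  have xy: "meet A ?m (meet A ?x ?y) = ?m" by (rule Hey_meet_left_le) simp_all
  have x: "meet A ?m ?x = ?m"
    by (rule Hey_le_trans[OF _ _ _ xy]) (simp_all add: Hey_meet_left_le)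
  have y: "meet A ?m ?y = ?m"
    by (rule Hey_le_trans[OF _ _ _ xy]) (simp_all add: Hey_meet_left_le)
  have a: "meet A ?m a = ?m" by (rule Hey_meet_left_le) simp_all
  have b: "meet A ?m b = ?m" by (rule Hey_mp[OF _ _ _ a y]) simp_all
  have bc: "meet A ?m (imp A b c) = ?m" by (rule Hey_mp[OF _ _ _ a x]) simp_all
  have "meet A ?m c = ?m" by (rule Hey_mp[OF _ _ _ b bc]) simp_all
  then have "meet A (meet A ?x ?y) (imp A a c) = meet A ?x ?y"
    by (simp add: Hey_laws(9))
  then have "meet A ?x (imp A ?y (imp A a c)) = ?x"
    by (simp add: Hey_laws(9))
  then show ?thesis by (simp add: Hey_imp_one_iff)
qed

lemma forget_simps [simp]:
  "carrier (forget A) = carrier A" "imp (forget A) = imp A" "one (forget A) = one A"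
  "join (forget A) = join A" "zero (forget A) = zero A"
  by (simp_all add: forget_def hil0.truncate_def)

lemma forget_Hil0: "forget A \<in> Hil0"
proof -
  have antisym: "a = b" if ab: "a \<in> carrier A" "b \<in> carrier A"
    and "imp A a b = one A" "imp A b a = one A" for a b
  proof -
    have "meet A a b = a" "meet A b a = b" using that Hey_imp_one_iff by simp_all
    then show ?thesis using Hey_laws(1)[OF ab] by simp
  qed
  have hilbert: "hilbert_algebra (forget A)"
    unfolding hilbert_algebra_def closed_op_def forget_simps
    by (intro conjI ballI impI) (auto intro: Hey_closed Hey_imp_K Hey_imp_S antisym)
  have join_one: "join A a (one A) = one A" if "a \<in> carrier A" for a
    using Hey_meet_join_iff[OF that Hey_closed(5)] Hey_laws(8)[OF that] by simp
  have semilattice: "join_semilattice_one (forget A)"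
    unfolding join_semilattice_one_def closed_op_def forget_simps
    by (intro conjI ballI) (auto intro: Hey_closed Hey_laws(2,4) Hey_join_idem join_one)
  have "imp A a b = one A \<longleftrightarrow> join A a b = b" if "a \<in> carrier A" "b \<in> carrier A" for a b
    using Hey_imp_one_iff[OF that] Hey_meet_join_iff[OF that] by simp
  moreover have "imp A (zero A) a = one A" if "a \<in> carrier A" for a
    using Hey_imp_one_iff[OF Hey_closed(4) that] Hey_laws(7)[OF that] by simp
  ultimately show ?thesis
    unfolding Hil0_def hilbert_algebra_sup_def hilbert_le_def mem_Collect_eq forget_simps
    using hilbert semilattice Hey_closed(4) by blast
qed

text \<open>
  Filters of \<open>A\<close> are closed under \<open>\<and>\<close> because \<open>a \<rightarrow> (b \<rightarrow> a \<and> b) = 1\<close>, although \<^const>\<open>implicative_filter\<close>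
  mentions implication only.
\<close>

lemma phi_forget_meet:
  assumes a: "a \<in> carrier A" and b: "b \<in> carrier A"
  shows "phi (forget A) (meet A a b) = phi (forget A) a \<inter> phi (forget A) b"
proof -
  have ab: "meet A a b \<in> carrier A" "imp A b (meet A a b) \<in> carrier A"
    using a b Hey_closed by simp_all
  have "meet A (meet A a b) (meet A a b) = meet A a b" by (rule Hey_meet_idem[OF ab(1)])
  then have le: "imp A a (imp A b (meet A a b)) = one A" "imp A (meet A a b) a = one A"
      "imp A (meet A a b) b = one A"
    using Hey_laws(9)[OF b ab(1) a] Hey_meet_left_le a b ab by (simp_all add: Hey_imp_one_iff)
  have "meet A a b \<in> P \<longleftrightarrow> a \<in> P \<and> b \<in> P" if P: "P \<in> irr_filters (forget A)" for P
  proof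
    note F = irr_filterD(1)[OF P]
    note up = filter_up[OF F, unfolded forget_simps] and mp = filter_mp[OF F, unfolded forget_simps]
    show "a \<in> P \<and> b \<in> P" if "meet A a b \<in> P"
      using up[OF that le(2) a] up[OF that le(3) b] by simp
    assume "a \<in> P \<and> b \<in> P"
    then show "meet A a b \<in> P"
      using mp[OF _ up[OF _ le(1) ab(2)] ab(1)] by simp
  qed
  then show ?thesis unfolding phi_def by auto
qed

end

lemma ident_simps: "x \<in> carrier H \<Longrightarrow> ident H x = x"
  by (simp add: ident_def)

lemma hey_homD:
  assumes "g \<in> hey_hom A B"
  shows "g \<in> carrier A \<rightarrow>\<^sub>E carrier B" "\<And>a. a \<in> carrier A \<Longrightarrow> g a \<in> carrier B"
    "\<And>a b. a \<in> carrier A \<Longrightarrow> b \<in> carrier A \<Longrightarrow> g (meet A a b) = meet B (g a) (g b)"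
    "\<And>a b. a \<in> carrier A \<Longrightarrow> b \<in> carrier A \<Longrightarrow> g (join A a b) = join B (g a) (g b)"
    "\<And>a b. a \<in> carrier A \<Longrightarrow> b \<in> carrier A \<Longrightarrow> g (imp A a b) = imp B (g a) (g b)"
    "g (zero A) = zero B" "g (one A) = one B"
  using assms unfolding hey_hom_def by auto

lemma hil0_homD:
  assumes "f \<in> hil0_hom H G"
  shows "f \<in> carrier H \<rightarrow>\<^sub>E carrier G" "\<And>a. a \<in> carrier H \<Longrightarrow> f a \<in> carrier G"
    "\<And>a b. a \<in> carrier H \<Longrightarrow> b \<in> carrier H \<Longrightarrow> f (join H a b) = join G (f a) (f b)"
    "\<And>a b. a \<in> carrier H \<Longrightarrow> b \<in> carrier H \<Longrightarrow> f (imp H a b) = imp G (f a) (f b)"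
    "f (zero H) = zero G" "f (one H) = one G"
  using assms unfolding hil0_hom_def by auto

lemma hey_hom_forget:
  assumes "A \<in> Hey" "B \<in> Hey" "k \<in> hey_hom A B"
  shows "k \<in> hil0_hom (forget A) (forget B)"
  using assms unfolding hil0_hom_def hey_hom_def by simp

lemma hey_hom_compose:
  assumes A: "A \<in> Hey" and f: "f \<in> hey_hom A B" and g: "g \<in> hey_hom B C"
  shows "compose (carrier A) g f \<in> hey_hom A C"
  using Hey_closed[OF A] hey_homD[OF f] hey_homD[OF g]
  unfolding hey_hom_def by (auto simp: compose_def)

lemma hey_hom_inv:
  assumes A: "A \<in> Hey" and f: "f \<in> hey_hom A B" and bij: "bij_betw f (carrier A) (carrier B)"
  shows "restrict (inv_into (carrier A) f) (carrier B) \<in> hey_hom B A"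
proof -
  let ?g = "inv_into (carrier A) f"
  note h = hey_homD[OF f] and c = Hey_closed[OF A]
  have inv: "?g (f a) = a" if "a \<in> carrier A" for a
    using bij that by (simp add: bij_betw_def)
  have surj: "\<exists>a\<in>carrier A. x = f a" if "x \<in> carrier B" for x
    using bij that unfolding bij_betw_def by blast
  have "?g (meet B x y) = meet A (?g x) (?g y) \<and> ?g (join B x y) = join A (?g x) (?g y) \<and>
      ?g (imp B x y) = imp A (?g x) (?g y) \<and>
      meet B x y \<in> carrier B \<and> join B x y \<in> carrier B \<and> imp B x y \<in> carrier B"
    if xy: "x \<in> carrier B" "y \<in> carrier B" for x y
  proof -
    obtain a b where "a \<in> carrier A" "x = f a" "b \<in> carrier A" "y = f b"
      using surj[OF xy(1)] surj[OF xy(2)] by blast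
    then show ?thesis
      by (simp add: inv c h(2) h(3-5)[symmetric])
  qed
  moreover have "?g x \<in> carrier A" if "x \<in> carrier B" for x
    using surj[OF that] inv by auto
  moreover have "zero B \<in> carrier B" "one B \<in> carrier B" "?g (zero B) = zero A" "?g (one B) = one A"
    using inv[of "zero A"] inv[of "one A"] h(2)[of "zero A"] h(2)[of "one A"] h(6,7) c(4,5) by auto
  ultimately show ?thesis unfolding hey_hom_def by auto
qed

section \<open>Generated Heyting subalgebras\<close>

lemma hey_generated_simps [simp]:
  "imp (hey_generated A S) = imp A" "one (hey_generated A S) = one A"
  "join (hey_generated A S) = join A" "zero (hey_generated A S) = zero A"
  "meet (hey_generated A S) = meet A"
  by (simp_all add: hey_generated_def)

lemma carrier_hey_generated: "carrier (hey_generated A S) = \<Inter>{B. hey_subuniverse A B \<and> S \<subseteq> B}"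
  by (simp add: hey_generated_def)

lemma hey_generated_least:
  assumes "hey_subuniverse A B" "S \<subseteq> B"
  shows "carrier (hey_generated A S) \<subseteq> B"
  unfolding carrier_hey_generated by (rule Inter_lower) (simp add: assms)

lemma hey_generated_superset: "S \<subseteq> carrier (hey_generated A S)"
  unfolding carrier_hey_generated by (rule Inter_greatest) simp

lemma hey_subuniverse_Inter:
  assumes "\<B> \<noteq> {}" and sub: "\<And>B. B \<in> \<B> \<Longrightarrow> hey_subuniverse A B"
  shows "hey_subuniverse A (\<Inter>\<B>)"
proof -
  obtain B where B: "B \<in> \<B>" using assms(1) by blast
  have "\<Inter>\<B> \<subseteq> B" using B by (rule Inter_lower)
  also have "B \<subseteq> carrier A" using sub[OF B] unfolding hey_subuniverse_def by (rule conjunct1)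
  finally show ?thesis
    using sub unfolding hey_subuniverse_def closed_op_def by simp
qed

lemma hey_generated_subuniverse:
  assumes A: "A \<in> Hey" and S: "S \<subseteq> carrier A"
  shows "hey_subuniverse A (carrier (hey_generated A S))"
  unfolding carrier_hey_generated
proof (rule hey_subuniverse_Inter)
  have "hey_subuniverse A (carrier A)"
    unfolding hey_subuniverse_def closed_op_def by (simp add: Hey_closed[OF A])
  then have "carrier A \<in> {B. hey_subuniverse A B \<and> S \<subseteq> B}" using S by simp
  then show "{B. hey_subuniverse A B \<and> S \<subseteq> B} \<noteq> {}" by fast
qed simp

lemma hey_generated_Hey:
  assumes A: "A \<in> Hey" and S: "S \<subseteq> carrier A"
  shows "hey_generated A S \<in> Hey"
proof -
  let ?B = "carrier (hey_generated A S)"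
  have sub: "hey_subuniverse A ?B" by (rule hey_generated_subuniverse[OF A S])
  then have "?B \<subseteq> carrier A" unfolding hey_subuniverse_def by (rule conjunct1)
  then have mem: "x \<in> carrier A" if "x \<in> ?B" for x using that by (rule subsetD)
  show ?thesis
    unfolding Hey_def mem_Collect_eq hey_generated_simps
  proof (intro conjI ballI)
    show "closed_op ?B (meet A)" "closed_op ?B (join A)" "closed_op ?B (imp A)"
      "zero A \<in> ?B" "one A \<in> ?B"
      using sub unfolding hey_subuniverse_def by simp_all
  qed (rule Hey_laws[OF A] mem | assumption)+
qed

text \<open>
  The equalizer of two homomorphisms is a subuniverse.
\<close>

lemma hey_hom_eq_on_generators:
  assumes A: "A \<in> Hey" and S: "S \<subseteq> carrier A"
    and g: "g \<in> hey_hom (hey_generated A S) B" and h: "h \<in> hey_hom (hey_generated A S) B"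
    and eq: "\<And>s. s \<in> S \<Longrightarrow> g s = h s"
  shows "g = h"
proof -
  let ?C = "carrier (hey_generated A S)"
  let ?E = "{x \<in> ?C. g x = h x}"
  have sub: "hey_subuniverse A ?C" by (rule hey_generated_subuniverse[OF A S])
  have "hey_subuniverse A ?E"
    using sub hey_homD(3-7)[OF g] hey_homD(3-7)[OF h]
    unfolding hey_subuniverse_def closed_op_def by auto
  moreover have "S \<subseteq> ?E" using eq hey_generated_superset[of S A] by blast
  ultimately have "?C \<subseteq> ?E" by (rule hey_generated_least)
  then show ?thesis
    using hey_homD(1)[OF g] hey_homD(1)[OF h] by (intro PiE_ext) auto
qed

section \<open>The functor into Heyting algebras\<close>

lemma phi_image_upsets: "phi H ` carrier H \<subseteq> carrier (upset_algebra (irr_filters H))"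
  by (auto simp: phi_def upsets_def)

lemma hey_of_Hey: "hey_of H \<in> Hey"
  unfolding hey_of_def by (rule hey_generated_Hey[OF upset_algebra_Hey phi_image_upsets])

lemma hey_of_simps [simp]:
  "one (hey_of H) = irr_filters H" "join (hey_of H) = (\<union>)"
  "zero (hey_of H) = {}" "meet (hey_of H) = (\<inter>)"
  "imp (hey_of H) U V = irr_filters H - downset (irr_filters H) (U \<inter> (irr_filters H - V))"
  by (simp_all add: hey_of_def)

lemma hey_of_subuniverse:
  "hey_subuniverse (upset_algebra (irr_filters H)) (carrier (hey_of H))"
  unfolding hey_of_def by (rule hey_generated_subuniverse[OF upset_algebra_Hey phi_image_upsets])

lemma hey_of_upset: "U \<in> carrier (hey_of H) \<Longrightarrow> U \<in> upsets (irr_filters H)"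
  using hey_of_subuniverse[of H, unfolded hey_subuniverse_def, THEN conjunct1] by (simp add: subsetD)

lemma phi_in_hey_of: "a \<in> carrier H \<Longrightarrow> phi H a \<in> carrier (hey_of H)"
  unfolding hey_of_def by (rule subsetD[OF hey_generated_superset]) (rule imageI)

lemma hey_of_hom_eqI:
  assumes "g \<in> hey_hom (hey_of H) A" "h \<in> hey_hom (hey_of H) A"
    and "\<And>a. a \<in> carrier H \<Longrightarrow> g (phi H a) = h (phi H a)"
  shows "g = h"
  by (rule hey_hom_eq_on_generators[OF upset_algebra_Hey phi_image_upsets
        assms(1,2)[unfolded hey_of_def]]) (erule imageE, simp add: assms(3))

definition hom_vimage :: "'a hil0 \<Rightarrow> ('a \<Rightarrow> 'b) \<Rightarrow> 'b set \<Rightarrow> 'a set" where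
  "hom_vimage H f P = {a \<in> carrier H. f a \<in> P}"

context
  fixes H :: "'a hil0" and G :: "'b hil0" and f :: "'a \<Rightarrow> 'b"
  assumes H: "H \<in> Hil0" and G: "G \<in> Hil0" and f: "f \<in> hil0_hom H G"
begin

lemma implicative_filter_vimage:
  assumes "implicative_filter G P"
  shows "implicative_filter H (hom_vimage H f P)"
  unfolding implicative_filter_def
proof (intro conjI ballI impI)
  show "hom_vimage H f P \<subseteq> carrier H" unfolding hom_vimage_def by auto
  show "one H \<in> hom_vimage H f P"
    using filter_one[OF assms] hil0_homD(6)[OF f] one_closed[OF Hil0D(2)[OF H]]
    unfolding hom_vimage_def by simp
  fix a b assume ab: "a \<in> carrier H" "b \<in> carrier H"
    and "a \<in> hom_vimage H f P \<and> imp H a b \<in> hom_vimage H f P"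
  then have "f a \<in> P" "imp G (f a) (f b) \<in> P"
    using hil0_homD(4)[OF f] unfolding hom_vimage_def by auto
  then have "f b \<in> P" by (rule filter_mp[OF assms _ _ hil0_homD(2)[OF f ab(2)]])
  then show "b \<in> hom_vimage H f P" using ab(2) unfolding hom_vimage_def by simp
qed

text \<open>
  Primeness is inherited by preimages since \<open>f\<close> preserves joins, and properness since it preserves
  \<open>0\<close>.
\<close>

lemma irr_filter_vimage:
  assumes P: "P \<in> irr_filters G"
  shows "hom_vimage H f P \<in> irr_filters H"
proof (rule prime_imp_irr[OF Hil0D(1)[OF H]])
  show "implicative_filter H (hom_vimage H f P)"
    by (rule implicative_filter_vimage[OF irr_filterD(1)[OF P]])
  have "zero H \<notin> hom_vimage H f P"
    using zero_notin_irr[OF G P] hil0_homD(5)[OF f] unfolding hom_vimage_def by simp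
  then show "hom_vimage H f P \<noteq> carrier H" using Hil0D(3)[OF H] by auto
next
  fix a b assume ab: "a \<in> carrier H" "b \<in> carrier H" and "join H a b \<in> hom_vimage H f P"
  then have "join G (f a) (f b) \<in> P"
    using hil0_homD(3)[OF f] unfolding hom_vimage_def by simp
  then show "a \<in> hom_vimage H f P \<or> b \<in> hom_vimage H f P"
    using irr_filter_prime[OF Hil0D(1)[OF G] P hil0_homD(2)[OF f ab(1)] hil0_homD(2)[OF f ab(2)]] ab
    unfolding hom_vimage_def by simp
qed

text \<open>
  The p-morphism property of \<open>P \<mapsto> f\<inverse>(P)\<close>. Primeness of \<open>Q\<close> makes \<open>f[H - Q]\<close> closed under joins, so there
  is a filter \<open>M \<supseteq> P\<close> maximal among those that miss it, whence \<open>f\<inverse>(M) \<subseteq> Q\<close>. For \<open>q \<in> Q\<close>, adjoining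
  \<open>f q\<close> to \<open>M\<close> still misses \<open>f[H - Q]\<close>: an \<open>f a\<close> in the extension gives \<open>q \<rightarrow> a \<in> f\<inverse>(M) \<subseteq> Q\<close>, so
  \<open>a \<in> Q\<close>. By maximality \<open>f q \<in> M\<close>.
\<close>

lemma vimage_lifting:
  assumes P: "P \<in> irr_filters G" and Q: "Q \<in> irr_filters H" and PQ: "hom_vimage H f P \<subseteq> Q"
  obtains P' where "P' \<in> irr_filters G" "P \<subseteq> P'" "hom_vimage H f P' = Q"
proof -
  note hG = Hil0D(2)[OF G]
  note FQ = irr_filterD(1)[OF Q]
  let ?I = "f ` (carrier H - Q)"
  have "join G x y \<in> ?I" if "x \<in> ?I" "y \<in> ?I" for x y
  proof -
    obtain a b where "a \<in> carrier H" "b \<in> carrier H" "a \<notin> Q" "b \<notin> Q" "x = f a" "y = f b"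
      using \<open>x \<in> ?I\<close> \<open>y \<in> ?I\<close> by blast
    then show ?thesis
      using irr_filter_prime[OF Hil0D(1)[OF H] Q] join_closed[OF Hil0D(1)[OF H]] hil0_homD(3)[OF f]
      by (metis DiffI imageI)
  qed
  moreover have "?I \<subseteq> carrier G" using hil0_homD(2)[OF f] by blast
  moreover have "?I \<noteq> {}" using irr_filterD(2,3)[OF Q] by blast
  moreover have "P \<inter> ?I = {}" using PQ unfolding hom_vimage_def by blast
  ultimately obtain M where M: "M \<in> irr_filters G" "P \<subseteq> M" "M \<inter> ?I = {}"
    and max: "\<And>N. implicative_filter G N \<Longrightarrow> M \<subseteq> N \<Longrightarrow> N \<inter> ?I = {} \<Longrightarrow> N = M"
    using maximal_disjoint_filter[OF Hil0D(1)[OF G] irr_filterD(1)[OF P], of ?I] by metis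
  note FM = irr_filterD(1)[OF M(1)]
  have MQ: "hom_vimage H f M \<subseteq> Q" using M(3) unfolding hom_vimage_def by blast
  moreover have "f q \<in> M" if q: "q \<in> Q" for q
  proof -
    have qH: "q \<in> carrier H" using q irr_filterD(3)[OF Q] by blast
    have fq: "f q \<in> carrier G" using qH hil0_homD(2)[OF f] by blast
    let ?N = "adjoin G M (f q)"
    have "?N \<inter> ?I = {}"
    proof (rule ccontr)
      assume "?N \<inter> ?I \<noteq> {}"
      then obtain a where a: "a \<in> carrier H" "a \<notin> Q" "imp G (f q) (f a) \<in> M"
        unfolding adjoin_def by blast
      then have "imp H q a \<in> hom_vimage H f M"
        using hil0_homD(4)[OF f qH a(1)] imp_closed[OF Hil0D(2)[OF H] qH a(1)]
        unfolding hom_vimage_def by simp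
      then show False using filter_mp[OF FQ q _ a(1)] MQ a(2) by blast
    qed
    then have "?N = M"
      using max implicative_filter_adjoin[OF hG FM fq] subset_adjoin[OF hG FM fq] by blast
    then show ?thesis using mem_adjoin[OF hG FM fq] by blast
  qed
  ultimately have "hom_vimage H f M = Q"
    using irr_filterD(3)[OF Q] unfolding hom_vimage_def by blast
  then show thesis using that M by blast
qed

text \<open>
  \<open>R_f(P)\<close> has the least element \<open>f\<inverse>(P)\<close>, so an upset contains all of \<open>R_f(P)\<close> iff it contains that
  element.
\<close>

lemma hey_of_map_eq:
  assumes U: "U \<in> carrier (hey_of H)"
  shows "hey_of_map H G f U = {P \<in> irr_filters G. hom_vimage H f P \<in> U}"
proof -
  have "filter_rel H G f `` {P} \<subseteq> U \<longleftrightarrow> hom_vimage H f P \<in> U" if P: "P \<in> irr_filters G" for P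
  proof -
    have "filter_rel H G f `` {P} = {Q \<in> irr_filters H. hom_vimage H f P \<subseteq> Q}"
      using P unfolding filter_rel_def hom_vimage_def by blast
    then show ?thesis
      using irr_filter_vimage[OF P] hey_of_upset[OF U] unfolding upsets_def by blast
  qed
  then show ?thesis using U unfolding hey_of_map_def by auto
qed

text \<open>
  Naturality of the unit.
\<close>

lemma hey_of_map_phi:
  assumes "a \<in> carrier H"
  shows "hey_of_map H G f (phi H a) = phi G (f a)"
  using assms irr_filter_vimage hey_of_map_eq[OF phi_in_hey_of[OF assms]]
  unfolding phi_def hom_vimage_def by auto

text \<open>
  Monotonicity of \<open>P \<mapsto> f\<inverse>(P)\<close> gives one inclusion and the lifting property gives the other.
\<close>

lemma vimage_imp:
  "{P \<in> irr_filters G. hom_vimage H f P \<in> imp (hey_of H) U V} =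
    imp (hey_of G) {P \<in> irr_filters G. hom_vimage H f P \<in> U} {P \<in> irr_filters G. hom_vimage H f P \<in> V}"
    (is "?L = ?R")
proof (rule set_eqI)
  fix P
  have "(\<forall>Q\<in>irr_filters H. hom_vimage H f P \<subseteq> Q \<longrightarrow> Q \<in> U \<longrightarrow> Q \<in> V) \<longleftrightarrow>
      (\<forall>P'\<in>irr_filters G. P \<subseteq> P' \<longrightarrow> hom_vimage H f P' \<in> U \<longrightarrow> hom_vimage H f P' \<in> V)"
    (is "?l \<longleftrightarrow> ?r") if P: "P \<in> irr_filters G"
  proof
    assume ?l
    show ?r
    proof (intro ballI impI)
      fix P' assume P': "P' \<in> irr_filters G" "P \<subseteq> P'" "hom_vimage H f P' \<in> U"
      have "hom_vimage H f P \<subseteq> hom_vimage H f P'" using P'(2) unfolding hom_vimage_def by auto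
      then show "hom_vimage H f P' \<in> V" using \<open>?l\<close> irr_filter_vimage[OF P'(1)] P'(3) by simp
    qed
  next
    assume ?r
    show ?l
    proof (intro ballI impI)
      fix Q assume Q: "Q \<in> irr_filters H" "hom_vimage H f P \<subseteq> Q" "Q \<in> U"
      obtain P' where "P' \<in> irr_filters G" "P \<subseteq> P'" "hom_vimage H f P' = Q"
        by (rule vimage_lifting[OF P Q(1,2)])
      then show "Q \<in> V" using \<open>?r\<close> Q(3) by auto
    qed
  qed
  then show "P \<in> ?L \<longleftrightarrow> P \<in> ?R"
    unfolding hey_of_simps upset_imp_iff mem_Collect_eq using irr_filter_vimage by auto
qed

text \<open>
  The upsets whose inverse image lies in \<open>hey_of G\<close> form a subuniverse that contains the generators.
\<close>

lemma vimage_in_hey_of: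
  assumes "U \<in> carrier (hey_of H)"
  shows "{P \<in> irr_filters G. hom_vimage H f P \<in> U} \<in> carrier (hey_of G)"
proof -
  let ?m = "\<lambda>U. {P \<in> irr_filters G. hom_vimage H f P \<in> U}"
  note c = Hey_closed[OF hey_of_Hey[of H]] and d = Hey_closed[OF hey_of_Hey[of G]]
  let ?B = "{U \<in> carrier (hey_of H). ?m U \<in> carrier (hey_of G)}"
  have ops: "meet (hey_of H) U V \<in> ?B" "join (hey_of H) U V \<in> ?B" "imp (hey_of H) U V \<in> ?B"
    if UV: "U \<in> ?B" "V \<in> ?B" for U V
  proof -
    have U: "U \<in> carrier (hey_of H)" "?m U \<in> carrier (hey_of G)"
      and V: "V \<in> carrier (hey_of H)" "?m V \<in> carrier (hey_of G)" using UV by simp_all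
    have "?m (meet (hey_of H) U V) = meet (hey_of G) (?m U) (?m V)"
      "?m (join (hey_of H) U V) = join (hey_of G) (?m U) (?m V)"
      unfolding hey_of_simps by auto
    then show "meet (hey_of H) U V \<in> ?B" "join (hey_of H) U V \<in> ?B"
      using c(1,2)[OF U(1) V(1)] d(1,2)[OF U(2) V(2)] by simp_all
    show "imp (hey_of H) U V \<in> ?B"
      using c(3)[OF U(1) V(1)] d(3)[OF U(2) V(2)] unfolding vimage_imp[symmetric] by simp
  qed
  have "?m (one (hey_of H)) = one (hey_of G)" "?m (zero (hey_of H)) = zero (hey_of G)"
    using irr_filter_vimage by auto
  then have bounds: "one (hey_of H) \<in> ?B" "zero (hey_of H) \<in> ?B" using c(4,5) d(4,5) by simp_all
  have "?B \<subseteq> upsets (irr_filters H)" using hey_of_upset by auto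
  then have "hey_subuniverse (upset_algebra (irr_filters H)) ?B"
    unfolding hey_subuniverse_def closed_op_def using ops bounds
    unfolding hey_of_simps upset_algebra_simps by simp
  moreover have "phi H ` carrier H \<subseteq> ?B"
  proof (rule image_subsetI)
    fix a assume a: "a \<in> carrier H"
    have "?m (phi H a) = phi G (f a)"
      using hey_of_map_phi[OF a] hey_of_map_eq[OF phi_in_hey_of[OF a]] by simp
    then show "phi H a \<in> ?B"
      using phi_in_hey_of[OF a] phi_in_hey_of[OF hil0_homD(2)[OF f a]] by simp
  qed
  ultimately have "carrier (hey_of H) \<subseteq> ?B"
    unfolding hey_of_def[of H] by (rule hey_generated_least)
  then show ?thesis using assms by auto
qed

lemma hey_of_map_hom: "hey_of_map H G f \<in> hey_hom (hey_of H) (hey_of G)"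
proof -
  note c = Hey_closed[OF hey_of_Hey[of H]]
  have ext: "hey_of_map H G f \<in> carrier (hey_of H) \<rightarrow>\<^sub>E carrier (hey_of G)"
  proof (rule PiE_I)
    fix U assume U: "U \<in> carrier (hey_of H)"
    show "hey_of_map H G f U \<in> carrier (hey_of G)"
      unfolding hey_of_map_eq[OF U] by (rule vimage_in_hey_of[OF U])
  qed (simp add: hey_of_map_def)
  have map: "hey_of_map H G f (zero (hey_of H)) = zero (hey_of G)"
    "hey_of_map H G f (one (hey_of H)) = one (hey_of G)"
    unfolding hey_of_map_eq[OF c(4)] hey_of_map_eq[OF c(5)] using irr_filter_vimage by auto
  have ops: "hey_of_map H G f (meet (hey_of H) U V) =
        meet (hey_of G) (hey_of_map H G f U) (hey_of_map H G f V)"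
      "hey_of_map H G f (join (hey_of H) U V) =
        join (hey_of G) (hey_of_map H G f U) (hey_of_map H G f V)"
      "hey_of_map H G f (imp (hey_of H) U V) =
        imp (hey_of G) (hey_of_map H G f U) (hey_of_map H G f V)"
    if U: "U \<in> carrier (hey_of H)" and V: "V \<in> carrier (hey_of H)" for U V
    unfolding hey_of_map_eq[OF c(1)[OF U V]] hey_of_map_eq[OF c(2)[OF U V]]
      hey_of_map_eq[OF c(3)[OF U V]] hey_of_map_eq[OF U] hey_of_map_eq[OF V]
    by (auto simp: vimage_imp[symmetric] simp del: hey_of_simps(5))
  show ?thesis
    unfolding hey_hom_def mem_Collect_eq by (intro conjI ballI ext map ops)
qed

end

lemma hil0_hom_compose:
  assumes H: "H \<in> Hil0" and f: "f \<in> hil0_hom H G" and g: "g \<in> hil0_hom G K"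
  shows "compose (carrier H) g f \<in> hil0_hom H K"
  using one_closed[OF Hil0D(2)[OF H]] Hil0D(3)[OF H] join_closed[OF Hil0D(1)[OF H]]
    imp_closed[OF Hil0D(2)[OF H]] hil0_homD[OF f] hil0_homD[OF g]
  unfolding hil0_hom_def by (auto simp: compose_def)

lemma hil0_hom_ident:
  assumes H: "H \<in> Hil0" shows "ident H \<in> hil0_hom H H"
  using one_closed[OF Hil0D(2)[OF H]] Hil0D(3)[OF H] join_closed[OF Hil0D(1)[OF H]]
    imp_closed[OF Hil0D(2)[OF H]]
  unfolding hil0_hom_def by (auto simp: ident_def)

lemma hey_hom_ident:
  assumes A: "A \<in> Hey" shows "ident A \<in> hey_hom A A"
  using Hey_closed[OF A] unfolding hey_hom_def by (auto simp: ident_def)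

lemma hey_of_map_ident:
  assumes H: "H \<in> Hil0"
  shows "hey_of_map H H (ident H) = ident (hey_of H)"
  by (rule hey_of_hom_eqI[OF hey_of_map_hom[OF H H hil0_hom_ident[OF H]] hey_hom_ident[OF hey_of_Hey]])
    (simp add: hey_of_map_phi[OF H H hil0_hom_ident[OF H]] ident_simps phi_in_hey_of)

lemma hey_of_map_compose:
  assumes H: "H \<in> Hil0" and G: "G \<in> Hil0" and K: "K \<in> Hil0"
    and f: "f \<in> hil0_hom H G" and g: "g \<in> hil0_hom G K"
  shows "hey_of_map H K (compose (carrier H) g f) =
    compose (carrier (hey_of H)) (hey_of_map G K g) (hey_of_map H G f)"
proof (rule hey_of_hom_eqI)
  have gf: "compose (carrier H) g f \<in> hil0_hom H K" by (rule hil0_hom_compose[OF H f g])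
  show "hey_of_map H K (compose (carrier H) g f) \<in> hey_hom (hey_of H) (hey_of K)"
    by (rule hey_of_map_hom[OF H K gf])
  show "compose (carrier (hey_of H)) (hey_of_map G K g) (hey_of_map H G f)
      \<in> hey_hom (hey_of H) (hey_of K)"
    by (rule hey_hom_compose[OF hey_of_Hey hey_of_map_hom[OF H G f] hey_of_map_hom[OF G K g]])
  fix a assume "a \<in> carrier H"
  then show "hey_of_map H K (compose (carrier H) g f) (phi H a) =
      compose (carrier (hey_of H)) (hey_of_map G K g) (hey_of_map H G f) (phi H a)"
    by (simp add: hey_of_map_phi[OF H K gf] hey_of_map_phi[OF H G f] hey_of_map_phi[OF G K g]
        compose_eq phi_in_hey_of hil0_homD(2)[OF f])
qed

section \<open>The adjunction\<close>

lemma transpose_map_apply: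
  "a \<in> carrier H \<Longrightarrow> transpose_map H g a = g (phi H a)"
  by (simp add: transpose_map_def forget_map_def compose_eq)

lemma transpose_map_hom:
  assumes H: "H \<in> Hil0" and A: "A \<in> Hey" and g: "g \<in> hey_hom (hey_of H) A"
  shows "transpose_map H g \<in> hil0_hom H (forget A)"
proof -
  note s = Hil0D(1)[OF H]
  have imp: "g (phi H (imp H a b)) = imp A (g (phi H a)) (g (phi H b))"
    if "a \<in> carrier H" "b \<in> carrier H" for a b
    using hey_homD(5)[OF g phi_in_hey_of phi_in_hey_of] that by (simp add: phi_imp[OF s])
  have join: "g (phi H (join H a b)) = join A (g (phi H a)) (g (phi H b))"
    if "a \<in> carrier H" "b \<in> carrier H" for a b
    using hey_homD(4)[OF g phi_in_hey_of phi_in_hey_of] that by (simp add: phi_join[OF s])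
  have "transpose_map H g \<in> extensional (carrier H)"
    by (simp add: transpose_map_def compose_def)
  then show ?thesis
    unfolding hil0_hom_def
    using hey_homD(2,6,7)[OF g] imp join one_closed[OF Hil0D(2)[OF H]] Hil0D(3)[OF H]
      join_closed[OF s] imp_closed[OF Hil0D(2)[OF H]] phi_in_hey_of[of _ H]
    by (simp add: transpose_map_apply PiE_iff phi_one[OF s] phi_zero[OF H] forget_simps[OF A])
qed

text \<open>
  For a Heyting algebra the representation map preserves every operation, so its image needs no
  further closure.
\<close>

lemma carrier_hey_of_forget:
  assumes A: "A \<in> Hey"
  shows "carrier (hey_of (forget A)) = phi (forget A) ` carrier A"
proof
  let ?H = "forget A" and ?X = "irr_filters (forget A)"
  note fs = forget_simps[OF A] and H = forget_Hil0[OF A]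
  note s = Hil0D(1)[OF H] and c = Hey_closed[OF A]
  let ?I = "phi ?H ` carrier A"
  have ops: "meet (upset_algebra ?X) (phi ?H a) (phi ?H b) \<in> ?I"
    "join (upset_algebra ?X) (phi ?H a) (phi ?H b) \<in> ?I"
    "imp (upset_algebra ?X) (phi ?H a) (phi ?H b) \<in> ?I"
    if a: "a \<in> carrier A" and b: "b \<in> carrier A" for a b
    unfolding upset_algebra_simps phi_forget_meet[OF A a b, symmetric]
      phi_join[OF s, unfolded fs, OF a b, symmetric] phi_imp[OF s, unfolded fs, OF a b, symmetric]
    by (intro imageI c a b)+
  have bounds: "zero (upset_algebra ?X) \<in> ?I" "one (upset_algebra ?X) \<in> ?I"
    unfolding upset_algebra_simps phi_zero[OF H, unfolded fs, symmetric]
      phi_one[OF s, unfolded fs, symmetric]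
    by (intro imageI c)+
  have "?I \<subseteq> upsets ?X" using phi_image_upsets[of ?H] by (simp add: fs)
  then have "hey_subuniverse (upset_algebra ?X) ?I"
    unfolding hey_subuniverse_def closed_op_def
    by (intro conjI ballI bounds) (auto intro: ops simp del: upset_algebra_simps(3-))
  then show "carrier (hey_of ?H) \<subseteq> ?I"
    unfolding hey_of_def fs by (rule hey_generated_least) (rule subset_refl)
  show "?I \<subseteq> carrier (hey_of ?H)"
    by (rule image_subsetI) (simp add: phi_in_hey_of fs)
qed

text \<open>
  The inverse of this isomorphism is the counit of the adjunction.
\<close>

lemma phi_forget_iso:
  assumes A: "A \<in> Hey"
  defines "u \<equiv> restrict (phi (forget A)) (carrier A)"
  shows "u \<in> hey_hom A (hey_of (forget A))" "bij_betw u (carrier A) (carrier (hey_of (forget A)))"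
proof -
  note fs = forget_simps[OF A] and H = forget_Hil0[OF A]
  note s = Hil0D(1)[OF H] and c = Hey_closed[OF A]
  show "u \<in> hey_hom A (hey_of (forget A))"
    unfolding hey_hom_def u_def
    using c phi_join[OF s] phi_imp[OF s] phi_one[OF s] phi_zero[OF H] phi_forget_meet[OF A]
      phi_in_hey_of[of _ "forget A"] fs by simp
  show "bij_betw u (carrier A) (carrier (hey_of (forget A)))"
    unfolding u_def carrier_hey_of_forget[OF A] bij_betw_def
    using phi_inj[OF s] fs by simp
qed

lemma transpose_map_bij:
  assumes H: "H \<in> Hil0" and A: "A \<in> Hey"
  shows "bij_betw (transpose_map H) (hey_hom (hey_of H) A) (hil0_hom H (forget A))"
  unfolding bij_betw_def
proof (intro conjI subset_antisym)
  show "inj_on (transpose_map H) (hey_hom (hey_of H) A)"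
  proof (rule inj_onI)
    fix g h assume gh: "g \<in> hey_hom (hey_of H) A" "h \<in> hey_hom (hey_of H) A"
      and eq: "transpose_map H g = transpose_map H h"
    have "g (phi H a) = h (phi H a)" if "a \<in> carrier H" for a
      using fun_cong[OF eq, of a] by (simp add: transpose_map_apply that)
    then show "g = h" by (rule hey_of_hom_eqI[OF gh])
  qed
  show "transpose_map H ` hey_hom (hey_of H) A \<subseteq> hil0_hom H (forget A)"
    by (rule image_subsetI) (rule transpose_map_hom[OF H A])
  show "hil0_hom H (forget A) \<subseteq> transpose_map H ` hey_hom (hey_of H) A"
  proof
    fix f assume f: "f \<in> hil0_hom H (forget A)"
    note fs = forget_simps[OF A] and U = forget_Hil0[OF A]
    \<comment> \<open>the counit \<open>?v\<close> after the functorial image of \<open>f\<close> extends \<open>f\<close> along the unit\<close>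
    let ?u = "restrict (phi (forget A)) (carrier A)"
    let ?v = "restrict (inv_into (carrier A) ?u) (carrier (hey_of (forget A)))"
    let ?g = "compose (carrier (hey_of H)) ?v (hey_of_map H (forget A) f)"
    have g: "?g \<in> hey_hom (hey_of H) A"
      by (rule hey_hom_compose[OF hey_of_Hey hey_of_map_hom[OF H U f]
            hey_hom_inv[OF A phi_forget_iso[OF A]]])
    have "transpose_map H ?g a = f a" if a: "a \<in> carrier H" for a
    proof -
      have fa: "f a \<in> carrier A" using hil0_homD(2)[OF f a] fs by simp
      have "inv_into (carrier A) ?u (?u (f a)) = f a"
        by (rule inv_into_f_f[OF bij_betw_imp_inj_on[OF phi_forget_iso(2)[OF A]] fa])
      then show ?thesis
        using a fa phi_in_hey_of[of "f a" "forget A"] fs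
        by (simp add: transpose_map_apply compose_eq phi_in_hey_of hey_of_map_phi[OF H U f])
    qed
    then have "transpose_map H ?g = f"
      by (rule PiE_ext[OF hil0_homD(1)[OF transpose_map_hom[OF H A g]] hil0_homD(1)[OF f]])
    then show "f \<in> transpose_map H ` hey_hom (hey_of H) A" using g by (rule image_eqI[OF sym])
  qed
qed

lemma transpose_map_natural_left:
  assumes H: "H \<in> Hil0" and G: "G \<in> Hil0" and f: "f \<in> hil0_hom H G"
  shows "transpose_map H (compose (carrier (hey_of H)) g (hey_of_map H G f)) =
    compose (carrier H) (transpose_map G g) f"
proof
  fix a show "transpose_map H (compose (carrier (hey_of H)) g (hey_of_map H G f)) a =
      compose (carrier H) (transpose_map G g) f a"
    using hey_of_map_phi[OF H G f, of a] hil0_homD(2)[OF f, of a] phi_in_hey_of[of a H]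
    by (simp add: transpose_map_def compose_def forget_map_def)
qed

lemma transpose_map_natural_right:
  "transpose_map H (compose (carrier (hey_of H)) k g) =
    compose (carrier H) (forget_map k) (transpose_map H g)"
proof
  fix a show "transpose_map H (compose (carrier (hey_of H)) k g) a =
      compose (carrier H) (forget_map k) (transpose_map H g) a"
    using phi_in_hey_of[of a H]
    by (simp add: transpose_map_def compose_def forget_map_def)
qed

theorem corollary15:
  shows
    "\<comment> \<open>the assignment on Hilbert algebras with supremum is a functor into Heyting algebras\<close>
     (\<forall>H \<in> (Hil0 :: 'a hil0 set). hey_of H \<in> Hey) \<and>
     (\<forall>H \<in> (Hil0 :: 'a hil0 set). \<forall>G \<in> (Hil0 :: 'b hil0 set). \<forall>f \<in> hil0_hom H G.
        hey_of_map H G f \<in> hey_hom (hey_of H) (hey_of G)) \<and>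
     (\<forall>H \<in> (Hil0 :: 'a hil0 set). hey_of_map H H (ident H) = ident (hey_of H)) \<and>
     (\<forall>H \<in> (Hil0 :: 'a hil0 set). \<forall>G \<in> (Hil0 :: 'b hil0 set). \<forall>K \<in> (Hil0 :: 'c hil0 set).
        \<forall>f \<in> hil0_hom H G. \<forall>g \<in> hil0_hom G K.
        hey_of_map H K (compose (carrier H) g f) =
          compose (carrier (hey_of H)) (hey_of_map G K g) (hey_of_map H G f)) \<and>
     \<comment> \<open>the forgetful assignment is a functor\<close>
     (\<forall>A \<in> (Hey :: 'd hey set). forget A \<in> Hil0) \<and>
     (\<forall>A \<in> (Hey :: 'd hey set). \<forall>B \<in> (Hey :: 'e hey set). \<forall>k \<in> hey_hom A B.
        forget_map k \<in> hil0_hom (forget A) (forget B)) \<and>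
     (\<forall>A \<in> (Hey :: 'd hey set). forget_map (ident A) = ident (forget A)) \<and>
     (\<forall>A \<in> (Hey :: 'd hey set). \<forall>B \<in> (Hey :: 'e hey set). \<forall>C \<in> (Hey :: 'f hey set).
        \<forall>k \<in> hey_hom A B. \<forall>l \<in> hey_hom B C.
        forget_map (compose (carrier A) l k) =
          compose (carrier (forget A)) (forget_map l) (forget_map k)) \<and>
     \<comment> \<open>bijection of hom-sets\<close>
     (\<forall>H \<in> (Hil0 :: 'a hil0 set). \<forall>A \<in> (Hey :: 'd hey set).
        bij_betw (transpose_map H) (hey_hom (hey_of H) A) (hil0_hom H (forget A))) \<and>
     \<comment> \<open>naturality in the Hilbert algebra\<close>
     (\<forall>H \<in> (Hil0 :: 'a hil0 set). \<forall>G \<in> (Hil0 :: 'b hil0 set). \<forall>A \<in> (Hey :: 'd hey set).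
        \<forall>f \<in> hil0_hom H G. \<forall>g \<in> hey_hom (hey_of G) A.
        transpose_map H (compose (carrier (hey_of H)) g (hey_of_map H G f)) =
          compose (carrier H) (transpose_map G g) f) \<and>
     \<comment> \<open>naturality in the Heyting algebra\<close>
     (\<forall>H \<in> (Hil0 :: 'a hil0 set). \<forall>A \<in> (Hey :: 'd hey set). \<forall>B \<in> (Hey :: 'e hey set).
        \<forall>g \<in> hey_hom (hey_of H) A. \<forall>k \<in> hey_hom A B.
        transpose_map H (compose (carrier (hey_of H)) k g) =
          compose (carrier H) (forget_map k) (transpose_map H g))"
proof (intro conjI ballI, goal_cases)
  case 6
  then show ?case unfolding forget_map_def by (intro hey_hom_forget)
next
  case 7
  then show ?case by (simp add: forget_map_def ident_def forget_simps)
next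
  case 8
  then show ?case by (simp add: forget_map_def forget_simps)
qed (rule hey_of_Hey hey_of_map_hom hey_of_map_ident hey_of_map_compose forget_Hil0
    transpose_map_bij transpose_map_natural_left transpose_map_natural_right; assumption)+

end
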